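(* Let $J\subset(0,\infty)$ be an interval, let $g:J\to(0,\infty)$ be a differentiable geometrically convex function and let $a,b\in J$. For $0\le t\le 1$ put $$G_t(g;a,b):=\log\frac{g(a)}{g(b)}-a^{1-t}b^t\left(\log\frac{a}{b}\right)\frac{g'(a^{1-t}b^t)}{g(a^{1-t}b^t)}.$$ Then for any $0\le t\le1$, $$\exp\left(G_0(g;a,b)\,t\right)\le \frac{g(a^{1-t}b^t)}{g(a)^{1-t}g(b)^t}\le \exp\left(G_t(g;a,b)\,t\right).$$
   Context: A function $g:J\to(0,\infty)$ on an interval $J\subset(0,\infty)$ is geometrically convex if $g(a^{1-\lambda}b^{\lambda})\le g(a)^{1-\lambda}g(b)^{\lambda}$ for all $a,b\in J$ and all $0\le\lambda\le1$. *)

theory Defs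
  imports "HOL-Analysis.Analysis"
begin

text \<open>
  Functions on an interval \<open>J\<close> are total functions considered on \<open>J\<close> only; that \<open>J\<close> is a
  subinterval of the positive reals and that \<open>g\<close> is positive on \<open>J\<close> are separate hypotheses
  wherever this notion is used.
\<close>

definition geometrically_convex_on :: "real set \<Rightarrow> (real \<Rightarrow> real) \<Rightarrow> bool" where
  "geometrically_convex_on J g \<longleftrightarrow>
     (\<forall>a\<in>J. \<forall>b\<in>J. \<forall>s\<in>{0..1}.
        g (a powr (1 - s) * b powr s) \<le> g a powr (1 - s) * g b powr s)"

text \<open>
  \<open>G g g' a b t\<close> is $G_t(g;a,b)$. The derivative \<open>g'\<close> of \<open>g\<close> relative to \<open>J\<close> (one-sided at an
  end point belonging to \<open>J\<close>) is passed explicitly, as \<open>deriv\<close> would refer to values of \<open>g\<close>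
  outside \<open>J\<close> there.
\<close>

definition G :: "(real \<Rightarrow> real) \<Rightarrow> (real \<Rightarrow> real) \<Rightarrow> real \<Rightarrow> real \<Rightarrow> real \<Rightarrow> real" where
  "G g g' a b t =
     ln (g a / g b)
     - a powr (1 - t) * b powr t * ln (a / b)
       * (g' (a powr (1 - t) * b powr t) / g (a powr (1 - t) * b powr t))"

end

theory Submission
  imports Defs
begin

text \<open>
  Along the geometric path \<open>x s = a powr (1 - s) * b powr s\<close> the function
  \<open>\<phi> s = ln (g (x s))\<close> is convex on \<open>{0..1}\<close>, and \<open>G g g' a b s = \<phi> 0 - \<phi> 1 + \<phi>' s\<close>.
  After taking logarithms, both bounds are tangent line inequalities for \<open>\<phi>\<close>:
  the lower one says that the tangent at \<open>0\<close> lies below \<open>\<phi>\<close> at \<open>t\<close>, the upper one that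
  the tangent at \<open>t\<close> lies below \<open>\<phi>\<close> at \<open>0\<close>.
\<close>

text \<open>
  Unlike \<open>convex_on_imp_above_tangent\<close>, this allows \<open>c\<close> to be a boundary point of \<open>A\<close>,
  which is needed for the tangent at \<open>0\<close>.
\<close>

lemma convex_on_imp_above_tangent_within:
  fixes f :: "real \<Rightarrow> real"
  assumes f: "convex_on A f" and c: "c \<in> A" and x: "x \<in> A"
    and deriv: "(f has_field_derivative D) (at c within A)"
  shows "f c + D * (x - c) \<le> f x"
proof -
  \<comment> \<open>Restricting \<open>f\<close> to the segment from \<open>c\<close> to
    \<open>x\<close> puts the base point at the left end of \<open>{0..1}\<close>, so only
    difference quotients with positive increment occur, even if \<open>c\<close> is a boundary point
    of \<open>A\<close>.\<close>
  define p where "p s = c + s * (x - c)" for s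
  have p_conv: "p s = (1 - s) *\<^sub>R c + s *\<^sub>R x" for s
    by (simp add: p_def algebra_simps)
  have "p ` {0..1} \<subseteq> A"
    using convex_on_imp_convex[OF f] c x by (auto simp: p_conv convex_alt)
  then have "(f has_field_derivative D) (at (p 0) within p ` {0..1})"
    using deriv by (auto simp: p_def intro: DERIV_subset)
  moreover have "(p has_field_derivative (x - c)) (at 0 within {0..1})"
    unfolding p_def by (auto intro!: derivative_eq_intros)
  ultimately have "(f \<circ> p has_field_derivative D * (x - c)) (at 0 within {0..1})"
    by (rule DERIV_image_chain)
  then have lim: "((\<lambda>s. (f (p s) - f c) / s) \<longlongrightarrow> D * (x - c)) (at 0 within {0..1})"
    by (simp add: has_field_derivative_iff p_def)
  have "(f (p s) - f c) / s \<le> f x - f c" if "s \<in> {0..1}" "s \<noteq> 0" for s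
  proof -
    have "f (p s) \<le> (1 - s) * f c + s * f x"
      unfolding p_conv using that by (intro convex_onD[OF f _ _ c x]) auto
    then show ?thesis
      using that by (simp add: field_simps)
  qed
  then have "eventually (\<lambda>s. (f (p s) - f c) / s \<le> f x - f c) (at 0 within {0..1})"
    by (auto simp: eventually_at_filter)
  from tendsto_upperbound[OF lim this] show ?thesis
    \<comment> \<open>What remains is that the filter is nontrivial; it equals
      \<open>at_right 0\<close>.\<close>
    by (simp add: at_within_Icc_at_right)
qed

lemma powr_path_exp:
  fixes a b :: real
  assumes "a > 0" "b > 0"
  shows "a powr (1 - s) * b powr s = exp ((1 - s) * ln a + s * ln b)"
  using assms by (simp add: powr_def exp_add)

text \<open>In logarithmic coordinates the path is the segment from \<open>ln a\<close> to
  \<open>ln b\<close>, so it stays between the smaller and the larger of \<open>a\<close> and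
  \<open>b\<close>.\<close>

lemma powr_path_in_interval:
  fixes J :: "real set"
  assumes J: "is_interval J" "J \<subseteq> {0<..}" and ab: "a \<in> J" "b \<in> J" and s: "s \<in> {0..1}"
  shows "a powr (1 - s) * b powr s \<in> J"
proof -
  have pos: "a > 0" "b > 0" using J ab by auto
  have "(1 - s) *\<^sub>R ln a + s *\<^sub>R ln b \<in> closed_segment (ln a) (ln b)"
    using s by (auto simp: closed_segment_def)
  then have "min (ln a) (ln b) \<le> (1 - s) * ln a + s * ln b"
    and "(1 - s) * ln a + s * ln b \<le> max (ln a) (ln b)"
    by (auto simp: closed_segment_eq_real_ivl split: if_splits)
  then have "exp (min (ln a) (ln b)) \<le> a powr (1 - s) * b powr s"
    and "a powr (1 - s) * b powr s \<le> exp (max (ln a) (ln b))"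
    by (simp_all add: powr_path_exp[OF pos])
  moreover have "exp (min (ln a) (ln b)) \<in> J" "exp (max (ln a) (ln b)) \<in> J"
    using pos ab by (auto simp: min_def max_def)
  ultimately show ?thesis
    using J(1) mem_is_interval_1_I by blast
qed

lemma geometrically_convex_on_imp_convex_on_ln:
  assumes J: "is_interval J" "J \<subseteq> {0<..}"
    and pos: "\<And>x. x \<in> J \<Longrightarrow> g x > 0"
    and g: "geometrically_convex_on J g"
    and ab: "a \<in> J" "b \<in> J"
  shows "convex_on {0..1} (\<lambda>s. ln (g (a powr (1 - s) * b powr s)))"
proof
  fix r u v :: real
  assume r: "0 < r" "r < 1" and u: "u \<in> {0..1}" and v: "v \<in> {0..1}"
  define x where "x s = a powr (1 - s) * b powr s" for s
  have ab0: "a > 0" "b > 0" using J ab by auto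
  have xJ: "x s \<in> J" if "s \<in> {0..1}" for s
    unfolding x_def using powr_path_in_interval[OF J ab that] .
  have w: "(1 - r) *\<^sub>R u + r *\<^sub>R v \<in> {0..1}"
    using convexD_alt[OF convex_real_interval(5) u v, of r] r by simp
  \<comment> \<open>Since \<open>ln (x s)\<close> is affine in \<open>s\<close>, averaging
    parameters amounts to taking the weighted geometric mean of path points, to which geometric
    convexity applies.\<close>
  have "x ((1 - r) *\<^sub>R u + r *\<^sub>R v) = x u powr (1 - r) * x v powr r"
    by (simp add: x_def powr_path_exp[OF ab0] powr_def flip: exp_add) (simp add: algebra_simps)
  also have "g \<dots> \<le> g (x u) powr (1 - r) * g (x v) powr r"
    using g r xJ[OF u] xJ[OF v] unfolding geometrically_convex_on_def by auto
  finally have "ln (g (x ((1 - r) *\<^sub>R u + r *\<^sub>R v))) \<le> ln (g (x u) powr (1 - r) * g (x v) powr r)"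
    using pos[OF xJ[OF w]] by (intro ln_mono)
  also have "\<dots> = (1 - r) * ln (g (x u)) + r * ln (g (x v))"
    using pos[OF xJ[OF u]] pos[OF xJ[OF v]] by (simp add: ln_mult ln_powr)
  finally show "ln (g (a powr (1 - ((1 - r) *\<^sub>R u + r *\<^sub>R v)) * b powr ((1 - r) *\<^sub>R u + r *\<^sub>R v)))
      \<le> (1 - r) * ln (g (a powr (1 - u) * b powr u)) + r * ln (g (a powr (1 - v) * b powr v))"
    by (simp add: x_def)
qed simp

lemma has_real_derivative_ln_powr_path:
  assumes J: "is_interval J" "J \<subseteq> {0<..}"
    and pos: "\<And>x. x \<in> J \<Longrightarrow> g x > 0"
    and deriv: "\<And>x. x \<in> J \<Longrightarrow> (g has_real_derivative g' x) (at x within J)"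
    and ab: "a \<in> J" "b \<in> J" and s: "s \<in> {0..1}"
  shows "((\<lambda>s. ln (g (a powr (1 - s) * b powr s))) has_real_derivative
           G g g' a b s - ln (g a / g b)) (at s within {0..1})"
proof -
  define x where "x s = a powr (1 - s) * b powr s" for s
  have ab0: "a > 0" "b > 0" using J ab by auto
  have xJ: "x s \<in> J" if "s \<in> {0..1}" for s
    unfolding x_def using powr_path_in_interval[OF J ab that] .
  have "(x has_real_derivative x s * (ln b - ln a)) (at s within {0..1})"
    unfolding x_def powr_path_exp[OF ab0] by (auto intro!: derivative_eq_intros)
  \<comment> \<open>The derivative of \<open>g\<close> is only relative to \<open>J\<close>; the
    chain rule needs it relative to the image of the path, which lies in \<open>J\<close>.\<close>
  moreover have "(g has_real_derivative g' (x s)) (at (x s) within x ` {0..1})"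
    using deriv[OF xJ[OF s]] xJ by (auto intro: DERIV_subset)
  ultimately have "(g \<circ> x has_real_derivative g' (x s) * (x s * (ln b - ln a))) (at s within {0..1})"
    by (rule DERIV_image_chain[rotated])
  from DERIV_chain2[OF DERIV_ln_divide this] pos[OF xJ[OF s]]
  have "((\<lambda>s. ln (g (x s))) has_real_derivative 1 / g (x s) * (g' (x s) * (x s * (ln b - ln a))))
      (at s within {0..1})"
    by simp
  moreover have "1 / g (x s) * (g' (x s) * (x s * (ln b - ln a))) = G g g' a b s - ln (g a / g b)"
    using ab0 by (simp add: G_def x_def ln_div divide_simps) (simp add: algebra_simps)
  ultimately show ?thesis
    by (simp add: x_def)
qed

theorem corollary2p9:
  fixes J :: "real set" and g g' :: "real \<Rightarrow> real" and a b t :: real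
  assumes "is_interval J" and "J \<subseteq> {0<..}"
    and "\<And>x. x \<in> J \<Longrightarrow> g x > 0"
    and "\<And>x. x \<in> J \<Longrightarrow> (g has_real_derivative g' x) (at x within J)"
    and "geometrically_convex_on J g"
    and "a \<in> J" and "b \<in> J"
    and "0 \<le> t" and "t \<le> 1"
  shows "exp (G g g' a b 0 * t)
           \<le> g (a powr (1 - t) * b powr t) / (g a powr (1 - t) * g b powr t)
       \<and> g (a powr (1 - t) * b powr t) / (g a powr (1 - t) * g b powr t)
           \<le> exp (G g g' a b t * t)"
proof -
  define \<phi> where "\<phi> s = ln (g (a powr (1 - s) * b powr s))" for s
  have ab0: "a > 0" "b > 0" using assms(2,6,7) by auto
  have g0: "g a > 0" "g b > 0" using assms(3,6,7) by auto
  have t: "t \<in> {0..1}" using assms(8,9) by simp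
  have gt: "g (a powr (1 - t) * b powr t) > 0"
    using assms(3) powr_path_in_interval[OF assms(1,2,6,7) t] .
  have convex: "convex_on {0..1} \<phi>"
    unfolding \<phi>_def
    using geometrically_convex_on_imp_convex_on_ln[OF assms(1,2,3,5,6,7)] .
  have deriv: "(\<phi> has_real_derivative G g g' a b s - ln (g a / g b)) (at s within {0..1})"
    if "s \<in> {0..1}" for s
    unfolding \<phi>_def
    using has_real_derivative_ln_powr_path[OF assms(1-4,6,7) that] .
  have \<phi>0: "\<phi> 0 = ln (g a)"
    using ab0 by (simp add: \<phi>_def)
  \<comment> \<open>The exponent is the gap between \<phi> and its chord over \<open>{0..1}\<close>,
    evaluated at \<open>t\<close>.\<close>
  have ratio: "g (a powr (1 - t) * b powr t) / (g a powr (1 - t) * g b powr t)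
      = exp (\<phi> t - (1 - t) * ln (g a) - t * ln (g b))"
    using g0 gt by (simp add: \<phi>_def powr_def exp_diff)
  \<comment> \<open>In both tangent inequalities \<open>t * ln (g a / g b)\<close> combines with
    \<open>ln (g a)\<close> to form the chord value at \<open>t\<close>, leaving the bounds
    \<open>G g g' a b 0 * t\<close> and \<open>G g g' a b t * t\<close> for this gap.\<close>
  have "\<phi> 0 + (G g g' a b 0 - ln (g a / g b)) * (t - 0) \<le> \<phi> t"
    using convex_on_imp_above_tangent_within[OF convex _ t deriv, of 0] by simp
  moreover have "\<phi> t + (G g g' a b t - ln (g a / g b)) * (0 - t) \<le> \<phi> 0"
    using convex_on_imp_above_tangent_within[OF convex t _ deriv[OF t], of 0] by simp
  ultimately show ?thesis
    unfolding ratio using g0 by (simp add: \<phi>0 ln_div algebra_simps)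
qed

end
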